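(* (Circle preserving.) Let $(\mathbf{p}_i^0,\mathbf{n}_i^0)$, $i\in\mathbb{Z}$, be initial control points and unit control normals sampled from a circle. Then all points and normals $(\mathbf{p}_i^k,\mathbf{n}_i^k)$, $i\in\mathbb{Z}$, $k\ge 1$, generated by univariate PN subdivision lie on the same circle, i.e. each $\mathbf{p}_i^k$ lies on the circle and $\mathbf{n}_i^k$ is the corresponding unit normal of the circle at $\mathbf{p}_i^k$.
   Context: Univariate PN (point-normal) subdivision. Let $\mathbf{a}=\{a_i:i\in\mathbb{Z}\}$ be a real mask with finite support satisfying $\sum_{j}a_{i-2j}=1$ for all $i\in\mathbb{Z}$. Given points $\mathbf{p}_i^k$ (in the plane or in 3D space) and unit vectors $\mathbf{n}_i^k$, $i\in\mathbb{Z}$, the next level is defined by $$\mathbf{q}_i^{k+1}=\sum_{j}a_{i-2j}\mathbf{p}_j^k,\qquad \mathbf{n}_i^{k+1}=\frac{\sum_j a_{i-2j}\mathbf{n}_j^k}{\left\|\sum_j a_{i-2j}\mathbf{n}_j^k\right\|},\qquad \mathbf{p}_i^{k+1}=\mathbf{q}_i^{k+1}+\sum_j a_{i-2j}h_{ij}^k\,\mathbf{n}_i^{k+1},$$ $$h_{ij}^k=\frac{(\mathbf{n}_j^k+\mathbf{n}_i^{k+1})^\top(\mathbf{p}_j^k-\mathbf{q}_i^{k+1})}{(\mathbf{n}_j^k+\mathbf{n}_i^{k+1})^\top\mathbf{n}_i^{k+1}}.$$ It is assumed that the denominators occurring with non-zero weights $a_{i-2j}$ do not vanish. Data are sampled from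 a circle with center $\mathbf{c}$ and radius $r>0$ when all $\mathbf{p}_i^0$ lie on the circle and $\mathbf{n}_i^0=\sigma(\mathbf{p}_i^0-\mathbf{c})/r$ with one common sign $\sigma\in\{1,-1\}$ for all $i$ (all normals outward or all inward). *)

theory Defs
  imports "HOL-Analysis.Analysis"
begin

text \<open>The sum over all integers \<open>j\<close> of \<open>a (i - 2 * j) *\<^sub>R f j\<close>: it is taken over the indices
  with non-zero weight, a finite set when \<open>a\<close> has finite support.\<close>

definition mask_sum :: "(int \<Rightarrow> real) \<Rightarrow> (int \<Rightarrow> 'a::real_vector) \<Rightarrow> int \<Rightarrow> 'a" where
  "mask_sum a f i = (\<Sum>j | a (i - 2 * j) \<noteq> 0. a (i - 2 * j) *\<^sub>R f j)"

definition subdivision_mask :: "(int \<Rightarrow> real) \<Rightarrow> bool" where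
  "subdivision_mask a \<longleftrightarrow>
     finite {i. a i \<noteq> 0} \<and> (\<forall>i. (\<Sum>j | a (i - 2 * j) \<noteq> 0. a (i - 2 * j)) = 1)"

definition pn_normal :: "(int \<Rightarrow> real) \<Rightarrow> (int \<Rightarrow> 'a::real_inner) \<Rightarrow> int \<Rightarrow> 'a" where
  "pn_normal a n i = (1 / norm (mask_sum a n i)) *\<^sub>R mask_sum a n i"

definition pn_height ::
  "(int \<Rightarrow> real) \<Rightarrow> (int \<Rightarrow> 'a::real_inner) \<Rightarrow> (int \<Rightarrow> 'a) \<Rightarrow> int \<Rightarrow> int \<Rightarrow> real" where
  "pn_height a p n i j =
     ((n j + pn_normal a n i) \<bullet> (p j - mask_sum a p i)) /
     ((n j + pn_normal a n i) \<bullet> pn_normal a n i)"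

definition pn_point ::
  "(int \<Rightarrow> real) \<Rightarrow> (int \<Rightarrow> 'a::real_inner) \<Rightarrow> (int \<Rightarrow> 'a) \<Rightarrow> int \<Rightarrow> 'a" where
  "pn_point a p n i =
     mask_sum a p i + mask_sum a (\<lambda>j. pn_height a p n i j *\<^sub>R pn_normal a n i) i"

text \<open>\<open>p k i\<close> and \<open>n k i\<close> are the \<open>i\<close>-th point and normal at level \<open>k\<close>.\<close>

definition pn_subdivision ::
  "(int \<Rightarrow> real) \<Rightarrow> (nat \<Rightarrow> int \<Rightarrow> 'a::real_inner) \<Rightarrow> (nat \<Rightarrow> int \<Rightarrow> 'a) \<Rightarrow> bool" where
  "pn_subdivision a p n \<longleftrightarrow>
     (\<forall>k i. n (Suc k) i = pn_normal a (n k) i \<and> p (Suc k) i = pn_point a (p k) (n k) i)"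

definition pn_denominators_nonzero ::
  "(int \<Rightarrow> real) \<Rightarrow> (int \<Rightarrow> 'a::real_inner) \<Rightarrow> bool" where
  "pn_denominators_nonzero a n \<longleftrightarrow>
     (\<forall>i. norm (mask_sum a n i) \<noteq> 0) \<and>
     (\<forall>i j. a (i - 2 * j) \<noteq> 0 \<longrightarrow> (n j + pn_normal a n i) \<bullet> pn_normal a n i \<noteq> 0)"

text \<open>A circle is cut out of a sphere by a two-dimensional plane through its center;
  in the plane itself, \<open>P\<close> is necessarily the whole space.\<close>

definition is_circle :: "'a::euclidean_space set \<Rightarrow> 'a \<Rightarrow> real \<Rightarrow> bool" where
  "is_circle C c r \<longleftrightarrow>
     r > 0 \<and> (\<exists>P. affine P \<and> aff_dim P = 2 \<and> c \<in> P \<and> C = sphere c r \<inter> P)"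

end

(* If every p_j = c + s n_j with unit normals n_j and s^2 = r^2, let m = |sum_j a_{i-2j} n_j| and
   let N be the new normal. Then q = c + s m N, and the numerator of h_ij factors as
   s (1 - m) (1 + n_j . N), so that h_ij = s (1 - m) does not depend on j. Hence the new point is
   q + s (1 - m) N = c + s N = c + (q - c) / m, which lies in every affine subspace containing
   c and all p_j. *)
theory Submission
  imports Defs
begin

lemma mask_sum_const:
  assumes "subdivision_mask a"
  shows "mask_sum a (\<lambda>_. v) i = v"
  using assms by (simp add: mask_sum_def subdivision_mask_def flip: scaleR_left.sum)

lemma mask_sum_add: "mask_sum a (\<lambda>j. f j + g j) i = mask_sum a f i + mask_sum a g i"
  by (simp add: mask_sum_def scaleR_add_right sum.distrib)

lemma mask_sum_scaleR: "mask_sum a (\<lambda>j. s *\<^sub>R f j) i = s *\<^sub>R mask_sum a f i"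
  by (simp add: mask_sum_def scaleR_sum_right mult.commute)

lemma mask_sum_cong:
  assumes "\<And>j. a (i - 2 * j) \<noteq> 0 \<Longrightarrow> f j = g j"
  shows "mask_sum a f i = mask_sum a g i"
  using assms by (simp add: mask_sum_def)

text \<open>Weights summing to 1 make a mask sum an affine combination. Translating by
  \<open>f 0\<close> turns \<open>P\<close> into a subspace, closed under the weighted sum, and the
  translation is undone because mask sums reproduce constants.\<close>

lemma mask_sum_affine:
  fixes f :: "int \<Rightarrow> 'a::euclidean_space"
  assumes mask: "subdivision_mask a" and "affine P" and f: "\<And>j. f j \<in> P"
  shows "mask_sum a f i \<in> P"
proof -
  let ?c = "f 0"
  have "subspace ((\<lambda>x. x - ?c) ` P)"
    using assms affine_diffs_subspace_subtract by blast
  then have "mask_sum a (\<lambda>j. f j - ?c) i \<in> (\<lambda>x. x - ?c) ` P"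
    unfolding mask_sum_def using f by (intro subspace_sum subspace_scale) auto
  moreover have "mask_sum a f i = mask_sum a (\<lambda>j. f j - ?c) i + ?c"
    using mask_sum_add[of a "\<lambda>j. f j - ?c" "\<lambda>_. ?c" i] by (simp add: mask_sum_const[OF mask])
  ultimately show ?thesis
    by auto
qed

lemma mask_sum_circle:
  assumes "subdivision_mask a" and "\<And>j. p j = c + s *\<^sub>R n j"
  shows "mask_sum a p i = c + s *\<^sub>R mask_sum a n i"
proof -
  have "p = (\<lambda>j. c + s *\<^sub>R n j)"
    using assms(2) by blast
  then show ?thesis
    by (simp add: mask_sum_add mask_sum_scaleR mask_sum_const[OF assms(1)])
qed

lemma pn_normal_circle:
  assumes "norm (mask_sum a n i) \<noteq> 0"
  shows "norm (pn_normal a n i) = 1"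
    and "mask_sum a n i = norm (mask_sum a n i) *\<^sub>R pn_normal a n i"
  using assms by (simp_all add: pn_normal_def)

lemma pn_height_circle:
  assumes "subdivision_mask a" and p: "\<And>j. p j = c + s *\<^sub>R n j" and n: "\<And>j. norm (n j) = 1"
    and M: "norm (mask_sum a n i) \<noteq> 0"
    and den: "(n j + pn_normal a n i) \<bullet> pn_normal a n i \<noteq> 0"
  shows "pn_height a p n i j = s * (1 - norm (mask_sum a n i))"
proof -
  define N where "N = pn_normal a n i"
  define m where "m = norm (mask_sum a n i)"
  have MN: "mask_sum a n i = m *\<^sub>R N" and N: "N \<bullet> N = 1"
    using pn_normal_circle[OF M] by (simp_all add: N_def m_def dot_square_norm)
  have nn: "n j \<bullet> n j = 1"
    using n by (simp add: dot_square_norm)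
  have diff: "p j - mask_sum a p i = s *\<^sub>R (n j - m *\<^sub>R N)"
    by (simp only: mask_sum_circle[OF assms(1) p] p[of j] MN) (simp add: algebra_simps)
  \<comment> \<open>Since \<open>n j\<close> and \<open>N\<close> are unit vectors,
    \<open>(n j + N) \<bullet> N\<close> is \<open>1 + n j \<bullet> N\<close>: the factor depending
    on \<open>j\<close> is exactly the denominator of the height.\<close>
  have "(n j + N) \<bullet> (p j - mask_sum a p i) = s * (1 - m) * ((n j + N) \<bullet> N)"
    unfolding diff by (simp add: inner_left_distrib inner_diff_right N nn inner_commute[of N "n j"])
      (simp add: algebra_simps)
  then show ?thesis
    using den by (simp add: pn_height_def flip: N_def m_def)
qed

lemma pn_point_circle:
  assumes mask: "subdivision_mask a" and p: "\<And>j. p j = c + s *\<^sub>R n j"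
    and n: "\<And>j. norm (n j) = 1" and den: "pn_denominators_nonzero a n"
  shows "pn_point a p n i = c + s *\<^sub>R pn_normal a n i"
proof -
  define N where "N = pn_normal a n i"
  define m where "m = norm (mask_sum a n i)"
  have M: "norm (mask_sum a n i) \<noteq> 0"
    using den by (simp add: pn_denominators_nonzero_def)
  \<comment> \<open>The heights are known only where the weight is non-zero, as only there is the
    denominator assumed not to vanish; the other indices do not enter the sum.\<close>
  have "mask_sum a (\<lambda>j. pn_height a p n i j *\<^sub>R N) i = mask_sum a (\<lambda>j. (s * (1 - m)) *\<^sub>R N) i"
  proof (rule mask_sum_cong)
    fix j assume "a (i - 2 * j) \<noteq> 0"
    then have "pn_height a p n i j = s * (1 - m)"
      unfolding m_def using den
      by (intro pn_height_circle[OF mask p n M]) (simp add: pn_denominators_nonzero_def)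
    then show "pn_height a p n i j *\<^sub>R N = (s * (1 - m)) *\<^sub>R N"
      by simp
  qed
  moreover have "mask_sum a p i = c + (s * m) *\<^sub>R N"
    unfolding mask_sum_circle[OF mask p] m_def N_def
    using pn_normal_circle(2)[OF M] by (metis scaleR_scaleR)
  ultimately show ?thesis
    unfolding pn_point_def N_def[symmetric]
    by (simp add: mask_sum_const[OF mask] algebra_simps)
qed

text \<open>In three dimensions the right distance from \<open>c\<close> gives only a sphere, so the
  plane of the circle has to be tracked separately. The new point is an affine combination of
  \<open>c\<close> and the mask sum of the points, which both lie in \<open>P\<close>.\<close>

lemma pn_point_affine:
  fixes p n :: "int \<Rightarrow> 'a::euclidean_space"
  assumes mask: "subdivision_mask a" and p: "\<And>j. p j = c + s *\<^sub>R n j"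
    and n: "\<And>j. norm (n j) = 1" and den: "pn_denominators_nonzero a n"
    and P: "affine P" "c \<in> P" "\<And>j. p j \<in> P"
  shows "pn_point a p n i \<in> P"
proof -
  let ?q = "mask_sum a p i" and ?t = "1 / norm (mask_sum a n i)"
  have "?q \<in> P"
    using mask_sum_affine[OF mask P(1)] P(3) .
  then have "(1 - ?t) *\<^sub>R c + ?t *\<^sub>R ?q \<in> P"
    using P by (intro mem_affine) auto
  moreover have "pn_point a p n i = (1 - ?t) *\<^sub>R c + ?t *\<^sub>R ?q"
    unfolding pn_point_circle[OF mask p n den] mask_sum_circle[OF mask p] pn_normal_def
    by (simp add: algebra_simps)
  ultimately show ?thesis
    by simp
qed

theorem mainTheorem1:
  fixes a :: "int \<Rightarrow> real"
    and p n :: "nat \<Rightarrow> int \<Rightarrow> 'a::euclidean_space"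
    and C :: "'a set" and c :: 'a and r \<sigma> :: real
  assumes dim: "DIM('a) = 2 \<or> DIM('a) = 3"
    and mask: "subdivision_mask a"
    and scheme: "pn_subdivision a p n"
    and nonvanishing: "\<And>k. pn_denominators_nonzero a (n k)"
    and circle: "is_circle C c r"
    and sign: "\<sigma> = 1 \<or> \<sigma> = -1"
    and points: "\<And>i. p 0 i \<in> C"
    and normals: "\<And>i. n 0 i = (\<sigma> / r) *\<^sub>R (p 0 i - c)"
  shows "\<forall>k\<ge>1. \<forall>i. p k i \<in> C \<and> n k i = (\<sigma> / r) *\<^sub>R (p k i - c)"
proof -
  from circle obtain P where r: "r > 0" and P: "affine P" "c \<in> P" and C: "C = sphere c r \<inter> P"
    by (auto simp: is_circle_def)
  have "\<forall>i. p k i \<in> C \<and> n k i = (\<sigma> / r) *\<^sub>R (p k i - c)" for k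
  proof (induction k)
    case 0
    show ?case
      using points normals by blast
  next
    case (Suc k)
    have onP: "p k i \<in> P" for i
      using Suc C by blast
    \<comment> \<open>Solves the normal relation for the point: \<open>\<sigma>\<close> squares to
      1, so \<open>\<sigma> * r\<close> is the reciprocal of \<open>\<sigma> / r\<close>. This is
      the \<open>s\<close> of the preceding lemmas, and its absolute value is
      \<open>r\<close>.\<close>
    have p: "p k i = c + (\<sigma> * r) *\<^sub>R n k i" for i
    proof -
      have "n k i = (\<sigma> / r) *\<^sub>R (p k i - c)"
        using Suc by blast
      moreover have "(\<sigma> * r) * (\<sigma> / r) = 1"
        using sign r by auto
      ultimately show ?thesis
        by simp
    qed
    \<comment> \<open>Unit length follows from the induction hypothesis: \<open>p k i\<close> has
      distance \<open>r\<close> from \<open>c\<close>.\<close>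
    have n: "norm (n k i) = 1" for i
      using Suc sign r C by (auto simp: dist_norm norm_minus_commute)
    note den = nonvanishing[of k]
    have new: "n (Suc k) i = pn_normal a (n k) i" "p (Suc k) i = pn_point a (p k) (n k) i" for i
      using scheme by (auto simp: pn_subdivision_def)
    have eq: "p (Suc k) i = c + (\<sigma> * r) *\<^sub>R n (Suc k) i" for i
      unfolding new by (rule pn_point_circle[OF mask p n den])
    have "norm (n (Suc k) i) = 1" for i
      unfolding new using den by (intro pn_normal_circle(1)) (simp add: pn_denominators_nonzero_def)
    then have "p (Suc k) i \<in> sphere c r" for i
      using sign r by (auto simp: eq dist_norm)
    moreover have "p (Suc k) i \<in> P" for i
      unfolding new by (rule pn_point_affine[OF mask p n den P onP])
    moreover have "n (Suc k) i = (\<sigma> / r) *\<^sub>R (p (Suc k) i - c)" for i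
      using sign r by (auto simp: eq)
    ultimately show ?case
      using C by blast
  qed
  then show ?thesis
    by blast
qed

end
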